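(* Let $V$ and $W$ be finite sets, $G\leq \mathrm{Sym}(V)$ and $H\leq \mathrm{Sym}(W)$. Let $G\times H$ act on $V\times W$ by the external direct product action $(g,h)\colon (v,w)\mapsto (g(v),h(w))$. Then $$\overline{\Gamma_{G\times H}}\cong \overline{\Gamma_G}\boxtimes \overline{\Gamma_H}.$$
   Context: For a permutation group $K$ on a finite set, an element is a derangement if it fixes no point. The derangement graph $\Gamma_K$ is the graph with vertex set $K$ in which distinct $g,h$ are adjacent iff $gh^{-1}$ is a derangement. $\overline{X}$ denotes the usual complement of a simple graph $X$ (no loops). The strong product $X\boxtimes Y$ of graphs has vertex set $V(X)\times V(Y)$, with $(x_1,y_1)$ adjacent to $(x_2,y_2)$ iff either ($x_1=x_2$ and $y_1y_2\in E(Y)$), or ($y_1=y_2$ and $x_1x_2\in E(X)$), or ($x_1x_2\in E(X)$ and $y_1y_2\in E(Y)$).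
   Formalization: The sets V and W are assumed nonempty; the claim fails otherwise, for example for V empty, W = {1,2,3} and H = Sym(W), where the left side has no edges but the right side does. *)

theory Defs
  imports "HOL-Algebra.Bij" "Graph_Theory.Digraph_Isomorphism" "Graph_Theory.Pair_Digraph"
begin

text \<open>
  A simple graph is a loop-free symmetric digraph without parallel arcs (locale
  \<open>pair_graph\<close>): each edge is represented by its two orientations.
  A permutation group on \<open>\<Omega>\<close> is a subgroup of \<open>BijGroup \<Omega>\<close>, whose elements
  are the bijections of \<open>\<Omega>\<close>, made extensional outside \<open>\<Omega>\<close>.
\<close>

definition derangement :: "'a set \<Rightarrow> ('a \<Rightarrow> 'a) \<Rightarrow> bool" where
  "derangement \<Omega> g \<longleftrightarrow> (\<forall>x\<in>\<Omega>. g x \<noteq> x)"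

definition derangement_graph :: "'a set \<Rightarrow> ('a \<Rightarrow> 'a) set \<Rightarrow> ('a \<Rightarrow> 'a) pair_pre_digraph" where
  "derangement_graph \<Omega> K =
    \<lparr> pverts = K,
      parcs = {(g, h). g \<in> K \<and> h \<in> K \<and> g \<noteq> h \<and>
        derangement \<Omega> (g \<otimes>\<^bsub>BijGroup \<Omega>\<^esub> inv\<^bsub>BijGroup \<Omega>\<^esub> h)} \<rparr>"

definition graph_complement :: "'a pair_pre_digraph \<Rightarrow> 'a pair_pre_digraph" where
  "graph_complement X =
    \<lparr> pverts = pverts X,
      parcs = {(x, y). x \<in> pverts X \<and> y \<in> pverts X \<and> x \<noteq> y \<and> (x, y) \<notin> parcs X} \<rparr>"

definition strong_product ::
    "'a pair_pre_digraph \<Rightarrow> 'b pair_pre_digraph \<Rightarrow> ('a \<times> 'b) pair_pre_digraph" where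
  "strong_product X Y =
    \<lparr> pverts = pverts X \<times> pverts Y,
      parcs = {((x1, y1), (x2, y2)).
        x1 \<in> pverts X \<and> x2 \<in> pverts X \<and> y1 \<in> pverts Y \<and> y2 \<in> pverts Y \<and>
        (x1 = x2 \<and> (y1, y2) \<in> parcs Y \<or>
         y1 = y2 \<and> (x1, x2) \<in> parcs X \<or>
         (x1, x2) \<in> parcs X \<and> (y1, y2) \<in> parcs Y)} \<rparr>"

definition graph_isomorphic :: "'a pair_pre_digraph \<Rightarrow> 'b pair_pre_digraph \<Rightarrow> bool" where
  "graph_isomorphic X Y \<longleftrightarrow> digraph_iso (with_proj X) (with_proj Y)"

definition prod_perm ::
    "'a set \<Rightarrow> 'b set \<Rightarrow> ('a \<Rightarrow> 'a) \<times> ('b \<Rightarrow> 'b) \<Rightarrow> ('a \<times> 'b \<Rightarrow> 'a \<times> 'b)" where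
  "prod_perm V W = (\<lambda>(g, h). \<lambda>(v, w)\<in>V \<times> W. (g v, h w))"

text \<open>
  \<open>G \<times> H\<close> as a permutation group on \<open>V \<times> W\<close> is the image of the action \<open>prod_perm V W\<close>.
  The action is faithful if \<open>V\<close> and \<open>W\<close> are nonempty (\<open>inj_on_prod_perm\<close> below).
\<close>

definition prod_perm_group ::
    "'a set \<Rightarrow> 'b set \<Rightarrow> ('a \<Rightarrow> 'a) set \<Rightarrow> ('b \<Rightarrow> 'b) set \<Rightarrow> ('a \<times> 'b \<Rightarrow> 'a \<times> 'b) set" where
  "prod_perm_group V W G H = prod_perm V W ` (G \<times> H)"

lemma graph_isomorphic_iff:
  assumes "pair_wf_digraph X" "pair_wf_digraph Y"
  shows "graph_isomorphic X Y \<longleftrightarrow>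
    (\<exists>f. bij_betw f (pverts X) (pverts Y) \<and>
      (\<forall>x\<in>pverts X. \<forall>y\<in>pverts X. (x, y) \<in> parcs X \<longleftrightarrow> (f x, f y) \<in> parcs Y))"
proof
  assume "graph_isomorphic X Y"
  then obtain i where i: "pre_digraph.digraph_isomorphism (with_proj X) i"
    and Y: "with_proj Y = app_iso i (with_proj X)"
    unfolding graph_isomorphic_def digraph_iso_def by blast
  have V: "pverts Y = iso_verts i ` pverts X" and A: "parcs Y = iso_arcs i ` parcs X"
    and T: "iso_tail i = fst" and H: "iso_head i = snd"
    using Y by (simp_all add: with_proj_def app_iso_def)
  have inj: "inj_on (iso_verts i) (pverts X)"
    using i by (simp add: pre_digraph.digraph_isomorphism_def)
  have arc: "iso_arcs i a = (iso_verts i (fst a), iso_verts i (snd a))" if "a \<in> parcs X" for a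
    using i that T H by (simp add: pre_digraph.digraph_isomorphism_def prod_eq_iff)
  have "(x, y) \<in> parcs X \<longleftrightarrow> (iso_verts i x, iso_verts i y) \<in> parcs Y"
    if xy: "x \<in> pverts X" "y \<in> pverts X" for x y
  proof
    assume "(x, y) \<in> parcs X"
    then show "(iso_verts i x, iso_verts i y) \<in> parcs Y" using arc A by force
  next
    assume "(iso_verts i x, iso_verts i y) \<in> parcs Y"
    then obtain a where a: "a \<in> parcs X" "(iso_verts i x, iso_verts i y) = iso_arcs i a"
      using A by blast
    then have "iso_verts i x = iso_verts i (fst a)" "iso_verts i y = iso_verts i (snd a)"
      using arc by simp_all
    moreover have "fst a \<in> pverts X" "snd a \<in> pverts X"
      using a assms(1) by (cases a; auto simp: pair_wf_digraph_def)+
    ultimately have "x = fst a" "y = snd a" using inj xy by (auto dest: inj_onD)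
    then show "(x, y) \<in> parcs X" using a by simp
  qed
  then show "\<exists>f. bij_betw f (pverts X) (pverts Y) \<and>
      (\<forall>x\<in>pverts X. \<forall>y\<in>pverts X. (x, y) \<in> parcs X \<longleftrightarrow> (f x, f y) \<in> parcs Y)"
    using inj V by (auto simp: bij_betw_def)
next
  assume "\<exists>f. bij_betw f (pverts X) (pverts Y) \<and>
      (\<forall>x\<in>pverts X. \<forall>y\<in>pverts X. (x, y) \<in> parcs X \<longleftrightarrow> (f x, f y) \<in> parcs Y)"
  then obtain f where f: "inj_on f (pverts X)" "f ` pverts X = pverts Y"
    and e: "\<And>x y. x \<in> pverts X \<Longrightarrow> y \<in> pverts X \<Longrightarrow> (x, y) \<in> parcs X \<longleftrightarrow> (f x, f y) \<in> parcs Y"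
    by (auto simp: bij_betw_def)
  have inX: "x \<in> pverts X" "y \<in> pverts X" if "(x, y) \<in> parcs X" for x y
    using that assms(1) by (auto simp: pair_wf_digraph_def)
  have inY: "x \<in> pverts Y" "y \<in> pverts Y" if "(x, y) \<in> parcs Y" for x y
    using that assms(2) by (auto simp: pair_wf_digraph_def)
  let ?i = "\<lparr> iso_verts = f, iso_arcs = map_prod f f, iso_head = snd, iso_tail = fst \<rparr>"
  have "inj_on (map_prod f f) (parcs X)"
    by (rule inj_on_subset[OF map_prod_inj_on[OF f(1) f(1)]]) (use inX in auto)
  moreover have "wf_digraph (with_proj X)"
    by unfold_locales (use inX in \<open>auto simp: with_proj_def\<close>)
  ultimately have "pre_digraph.digraph_isomorphism (with_proj X) ?i"
    using f(1) by (simp add: pre_digraph.digraph_isomorphism_def)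
  moreover have "map_prod f f ` parcs X = parcs Y"
  proof
    show "map_prod f f ` parcs X \<subseteq> parcs Y"
    proof
      fix b assume "b \<in> map_prod f f ` parcs X"
      then obtain x y where "(x, y) \<in> parcs X" "b = (f x, f y)" by auto
      then show "b \<in> parcs Y" using e inX by blast
    qed
    show "parcs Y \<subseteq> map_prod f f ` parcs X"
    proof
      fix b assume b: "b \<in> parcs Y"
      obtain u v where uv: "b = (u, v)" by fastforce
      have "u \<in> f ` pverts X" "v \<in> f ` pverts X" using inY b f(2) by (simp_all add: uv)
      then obtain x y where xy: "x \<in> pverts X" "y \<in> pverts X" "u = f x" "v = f y" by blast
      then have "(x, y) \<in> parcs X" using e b uv by simp
      then show "b \<in> map_prod f f ` parcs X" using xy uv by (simp add: image_iff) (metis map_prod_simp)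
    qed
  qed
  then have "with_proj Y = app_iso ?i (with_proj X)"
    using f(2) by (simp add: with_proj_def app_iso_def)
  ultimately show "graph_isomorphic X Y"
    unfolding graph_isomorphic_def digraph_iso_def by blast
qed

lemma prod_perm_in_Bij:
  assumes "g \<in> Bij V" "h \<in> Bij W"
  shows "prod_perm V W (g, h) \<in> Bij (V \<times> W)"
proof -
  have "bij_betw (map_prod g h) (V \<times> W) (V \<times> W)"
    using assms by (intro bij_betw_map_prod) (auto simp: Bij_def)
  then have "bij_betw (prod_perm V W (g, h)) (V \<times> W) (V \<times> W)"
    by (rule bij_betw_cong[THEN iffD1, rotated]) (auto simp: prod_perm_def)
  then show ?thesis by (auto simp: Bij_def prod_perm_def)
qed

lemma prod_perm_hom:
  "prod_perm V W \<in> hom (BijGroup V \<times>\<times> BijGroup W) (BijGroup (V \<times> W))"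
proof (rule homI)
  fix p assume "p \<in> carrier (BijGroup V \<times>\<times> BijGroup W)"
  then show "prod_perm V W p \<in> carrier (BijGroup (V \<times> W))"
    using prod_perm_in_Bij by (fastforce simp: BijGroup_def)
next
  fix p q
  assume p: "p \<in> carrier (BijGroup V \<times>\<times> BijGroup W)"
    and q: "q \<in> carrier (BijGroup V \<times>\<times> BijGroup W)"
  obtain a b c d where [simp]: "p = (a, b)" "q = (c, d)" by fastforce
  have m: "a \<in> Bij V" "b \<in> Bij W" "c \<in> Bij V" "d \<in> Bij W"
    using p q by (auto simp: BijGroup_def)
  then have "c ` V = V" "d ` W = W" by (auto simp: Bij_def bij_betw_def)
  then have "compose (V \<times> W) (prod_perm V W p) (prod_perm V W q)
      = prod_perm V W (compose V a c, compose W b d)"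
    by (auto simp: prod_perm_def compose_def fun_eq_iff)
  then show "prod_perm V W (p \<otimes>\<^bsub>BijGroup V \<times>\<times> BijGroup W\<^esub> q) =
      prod_perm V W p \<otimes>\<^bsub>BijGroup (V \<times> W)\<^esub> prod_perm V W q"
    using m by (simp add: BijGroup_def prod_perm_in_Bij)
qed

lemma inj_on_prod_perm:
  assumes "V \<noteq> {}" "W \<noteq> {}"
  shows "inj_on (prod_perm V W) (Bij V \<times> Bij W)"
proof (rule inj_onI, clarify)
  fix a b c d
  assume m: "a \<in> Bij V" "b \<in> Bij W" "c \<in> Bij V" "d \<in> Bij W"
    and e: "prod_perm V W (a, b) = prod_perm V W (c, d)"
  have "a v = c v \<and> b w = d w" if "v \<in> V" "w \<in> W" for v w
    using fun_cong[OF e, of "(v, w)"] that by (simp add: prod_perm_def)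
  then have "\<forall>v\<in>V. a v = c v" "\<forall>w\<in>W. b w = d w" using assms by auto
  then show "a = c \<and> b = d"
    using m by (auto simp: Bij_def intro: extensionalityI)
qed

lemma subgroup_prod_perm_group:
  assumes "subgroup G (BijGroup V)" "subgroup H (BijGroup W)"
  shows "subgroup (prod_perm_group V W G H) (BijGroup (V \<times> W))"
proof -
  interpret group_hom "BijGroup V \<times>\<times> BijGroup W" "BijGroup (V \<times> W)" "prod_perm V W"
    by (simp add: group_hom_def group_hom_axioms_def DirProd_group group_BijGroup prod_perm_hom)
  have "subgroup (G \<times> H) (BijGroup V \<times>\<times> BijGroup W)"
    by (intro DirProd_subgroups group_BijGroup assms)
  then show ?thesis
    unfolding prod_perm_group_def by (rule subgroup_img_is_subgroup)
qed

end

theory Submission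
  imports Defs
begin

text \<open>
  The permutation \<open>g h\<inverse>\<close> fixes \<open>h x\<close> iff \<open>g x = h x\<close>, so two distinct group elements are adjacent
  in the complement of the derangement graph iff they agree at some point.
  The pairs \<open>(g, h)\<close> and \<open>(g', h')\<close> agree at \<open>(v, w)\<close> iff \<open>g v = g' v\<close> and \<open>h w = h' w\<close>, so the
  faithful action identifies \<open>G \<times> H\<close> with its image and "agree and differ" on pairs is
  adjacency in the strong product; when one coordinate is equal, nonemptiness of the
  corresponding set provides the point of agreement.
\<close>

lemma derangement_mult_inv_iff:
  assumes g: "g \<in> Bij \<Omega>" and h: "h \<in> Bij \<Omega>"
  shows "derangement \<Omega> (g \<otimes>\<^bsub>BijGroup \<Omega>\<^esub> inv\<^bsub>BijGroup \<Omega>\<^esub> h) \<longleftrightarrow> (\<forall>x\<in>\<Omega>. g x \<noteq> h x)"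
proof -
  have h': "inj_on h \<Omega>" "h ` \<Omega> = \<Omega>" using h by (auto simp: Bij_def bij_betw_def)
  have "g \<otimes>\<^bsub>BijGroup \<Omega>\<^esub> inv\<^bsub>BijGroup \<Omega>\<^esub> h = compose \<Omega> g (\<lambda>x\<in>\<Omega>. inv_into \<Omega> h x)"
    unfolding inv_BijGroup[OF h] using g restrict_inv_into_Bij[OF h] by (simp add: BijGroup_def)
  then have "derangement \<Omega> (g \<otimes>\<^bsub>BijGroup \<Omega>\<^esub> inv\<^bsub>BijGroup \<Omega>\<^esub> h) \<longleftrightarrow>
      (\<forall>y\<in>\<Omega>. g (inv_into \<Omega> h y) \<noteq> y)"
    by (simp add: derangement_def compose_def)
  \<comment> \<open>Since \<open>h\<close> maps \<Omega> onto itself, every point has the form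
    \<open>h x\<close>; injectivity then cancels \<open>inv_into\<close> against
    \<open>h\<close>.\<close>
  also have "\<dots> \<longleftrightarrow> (\<forall>y\<in>h ` \<Omega>. g (inv_into \<Omega> h y) \<noteq> y)"
    by (simp only: h'(2))
  also have "\<dots> \<longleftrightarrow> (\<forall>x\<in>\<Omega>. g x \<noteq> h x)"
    using h'(1) by simp
  finally show ?thesis .
qed

lemma complement_derangement_graph:
  assumes "K \<subseteq> Bij \<Omega>"
  shows "graph_complement (derangement_graph \<Omega> K) =
    \<lparr> pverts = K, parcs = {(g, h). g \<in> K \<and> h \<in> K \<and> g \<noteq> h \<and> (\<exists>x\<in>\<Omega>. g x = h x)} \<rparr>"
  using assms
  by (auto simp: graph_complement_def derangement_graph_def derangement_mult_inv_iff subset_iff)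

theorem theorem3p1:
  fixes V :: "'a set" and W :: "'b set"
    and G :: "('a \<Rightarrow> 'a) set" and H :: "('b \<Rightarrow> 'b) set"
  assumes "finite V" and "finite W" and "V \<noteq> {}" and "W \<noteq> {}"
    and "subgroup G (BijGroup V)" and "subgroup H (BijGroup W)"
  shows "graph_isomorphic
    (graph_complement (derangement_graph (V \<times> W) (prod_perm_group V W G H)))
    (strong_product
      (graph_complement (derangement_graph V G))
      (graph_complement (derangement_graph W H)))"
proof -
  let ?P = "prod_perm V W" and ?K = "prod_perm_group V W G H"
  \<comment> \<open>The isomorphism runs from the image group back to pairs, so it inverts the
    action; faithfulness makes this inverse well defined.\<close>
  let ?f = "the_inv_into (G \<times> H) ?P"
  have G: "G \<subseteq> Bij V" and H: "H \<subseteq> Bij W"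
    using assms(5,6)[THEN subgroup.subset] by (simp_all add: BijGroup_def)
  have K: "?K \<subseteq> Bij (V \<times> W)"
    using G H by (auto simp: prod_perm_group_def intro: prod_perm_in_Bij)
  have inj: "inj_on ?P (G \<times> H)"
    using inj_on_prod_perm[OF assms(3,4)] by (rule inj_on_subset) (use G H in auto)
  have bij: "bij_betw ?f ?K (G \<times> H)"
    unfolding prod_perm_group_def using inj by (intro bij_betw_the_inv_into inj_on_imp_bij_betw)
  have f: "?f (?P p) = p" if "p \<in> G \<times> H" for p
    using inj that by (rule the_inv_into_f_f)
  let ?X = "graph_complement (derangement_graph (V \<times> W) ?K)"
  let ?Y = "strong_product (graph_complement (derangement_graph V G))
    (graph_complement (derangement_graph W H))"
  have arc: "(?P (g, h), ?P (g', h')) \<in> parcs ?X \<longleftrightarrow> ((g, h), (g', h')) \<in> parcs ?Y"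
    if m: "g \<in> G" "h \<in> H" "g' \<in> G" "h' \<in> H" for g h g' h'
  proof -
    have "?P (g, h) = ?P (g', h') \<longleftrightarrow> g = g' \<and> h = h'"
      using inj_on_eq_iff[OF inj, of "(g, h)" "(g', h')"] m by simp
    moreover have "?P (g, h) \<in> ?K" "?P (g', h') \<in> ?K"
      using m by (auto simp: prod_perm_group_def)
    \<comment> \<open>The two coordinates of a common point can be chosen independently.\<close>
    moreover have "(\<exists>x\<in>V \<times> W. ?P (g, h) x = ?P (g', h') x) \<longleftrightarrow>
        (\<exists>v\<in>V. g v = g' v) \<and> (\<exists>w\<in>W. h w = h' w)"
      by (auto simp: prod_perm_def)
    \<comment> \<open>Distinct pairs differ in the second coordinate only, in the first only, or in
      both: these are the three clauses of \<open>strong_product\<close>.\<close>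
    ultimately show ?thesis
      using m assms(3,4)
      by (auto simp: strong_product_def complement_derangement_graph[OF K]
        complement_derangement_graph[OF G] complement_derangement_graph[OF H])
  qed
  have "pverts ?X = ?K" "pverts ?Y = G \<times> H"
    by (simp_all add: graph_complement_def derangement_graph_def strong_product_def)
  moreover have "(x, y) \<in> parcs ?X \<longleftrightarrow> (?f x, ?f y) \<in> parcs ?Y" if "x \<in> ?K" "y \<in> ?K" for x y
  proof -
    obtain g h g' h' where "g \<in> G" "h \<in> H" "g' \<in> G" "h' \<in> H" "x = ?P (g, h)" "y = ?P (g', h')"
      using \<open>x \<in> ?K\<close> \<open>y \<in> ?K\<close> by (auto simp: prod_perm_group_def)
    then show ?thesis
      using arc[of g h g' h'] f[of "(g, h)"] f[of "(g', h')"] by simp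
  qed
  \<comment> \<open>Well-formedness of both graphs lets \<open>graph_isomorphic_iff\<close> reduce
    the goal to a vertex bijection that preserves and reflects arcs.\<close>
  moreover have "pair_wf_digraph ?X"
    by (auto simp: pair_wf_digraph_def graph_complement_def)
  moreover have "pair_wf_digraph ?Y"
    by (auto simp: pair_wf_digraph_def strong_product_def)
  ultimately show ?thesis
    using bij by (simp only: graph_isomorphic_iff) blast
qed

end
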